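(* Let $1<\alpha<2$, let $a,b\in\mathbb{R}$ be such that $b-a$ is an integer with $b-a\ge 2$, and let $q:\mathbb{N}^{b}_{a+2}\to\mathbb{R}$. If the discrete fractional boundary value problem $$\begin{cases}(\nabla^{\alpha}_{a}u)(t)+q(t)u(t)=0,\quad t\in\mathbb{N}^{b}_{a+2},\\ u(a+1)=0,\quad (\nabla^{\alpha-1}_{a}u)(b)=0,\end{cases}$$ has a nontrivial solution $u:\mathbb{N}^{b}_{a+1}\to\mathbb{R}$ (i.e. a solution not identically zero), then $$\sum_{s=a+2}^{b}|q(s)|\ \ge\ \frac{\Gamma(\alpha)}{(b-a-1)^{\overline{\alpha-1}}}.$$
   Context: For $a,b\in\mathbb{R}$ with $b-a\in\mathbb{Z}$: $\mathbb{N}_a=\{a,a+1,a+2,\dots\}$ and $\mathbb{N}_a^b=\{a,a+1,\dots,b\}$ (empty if $b<a$). Empty sums are $0$. The generalized rising function is $t^{\overline{r}}=\Gamma(t+r)/\Gamma(t)$ for $t,t+r\in\mathbb{R}\setminus\{0,-1,-2,\dots\}$, and $0^{\overline r}:=0$. The nabla difference is $(\nabla u)(t)=u(t)-u(t-1)$, and $\nabla^N$ is its $N$-fold iterate. For $\nu>0$ the nabla fractional sum based at $a$ is $(\nabla_a^{-\nu}u)(t)=\frac{1}{\Gamma(\nu)}\sum_{s=a+1}^{t}(t-s+1)^{\overline{\nu-1}}u(s)$ (so $(\nabla_a^{-\nu}u)(a)=0$ as an empty sum), and $\nabla_a^{-0}u=u$. For $\nu>0$ and a positive integer $N$ with $N-1<\nu\le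 N$, the Riemann-Liouville nabla fractional difference is $(\nabla_a^{\nu}u)(t)=\big(\nabla^N(\nabla_a^{-(N-\nu)}u)\big)(t)$, $t\in\mathbb{N}_{a+N}$. These values at $t$ depend only on $u(a+1),\dots,u(t)$, so they make sense for $u$ defined on $\mathbb{N}_{a+1}^b$ and $t\le b$. *)

theory Defs
  imports "HOL-Analysis.Analysis"
begin

text \<open>
  Functions on a discrete interval are represented by total functions on the reals;
  values outside the interval are irrelevant. For noninteger \<open>\<nu>\<close> the fractional difference below
  uses only \<open>u (a + 1), \<dots>, u t\<close>.
\<close>

definition nabla_Icc :: "real \<Rightarrow> real \<Rightarrow> real set" where
  "nabla_Icc a b = {t. t \<le> b \<and> (\<exists>k::nat. t = a + real k)}"

text \<open>
  The generalized rising function, meaningful when \<open>t = 0\<close> or when neither \<open>t\<close> nor \<open>t + r\<close>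
  is a nonpositive integer; other values are artefacts of totality.
\<close>

definition rising :: "real \<Rightarrow> real \<Rightarrow> real" where
  "rising t r = (if t = 0 then 0 else Gamma (t + r) / Gamma t)"

definition nabla :: "(real \<Rightarrow> real) \<Rightarrow> real \<Rightarrow> real" where
  "nabla u t = u t - u (t - 1)"

text \<open>The nabla fractional sum of order \<open>\<nu> \<ge> 0\<close> based at \<open>a\<close>.\<close>

definition nabla_frac_sum :: "real \<Rightarrow> real \<Rightarrow> (real \<Rightarrow> real) \<Rightarrow> real \<Rightarrow> real" where
  "nabla_frac_sum a \<nu> u t =
     (if \<nu> = 0 then u t
      else 1 / Gamma \<nu> * (\<Sum>s\<in>nabla_Icc (a + 1) t. rising (t - s + 1) (\<nu> - 1) * u s))"

text \<open>
  The Riemann--Liouville nabla fractional difference of order \<open>\<nu> > 0\<close> based at \<open>a\<close>.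
  The ceiling of \<open>\<nu>\<close> is the unique positive integer \<open>N\<close> with \<open>N - 1 < \<nu> \<le> N\<close>, and the
  values are meaningful for \<open>t\<close> in \<open>{a + N, a + N + 1, \<dots>}\<close>.
\<close>

definition nabla_frac_diff :: "real \<Rightarrow> real \<Rightarrow> (real \<Rightarrow> real) \<Rightarrow> real \<Rightarrow> real" where
  "nabla_frac_diff a \<nu> u t =
     (let N = nat \<lceil>\<nu>\<rceil> in (nabla ^^ N) (nabla_frac_sum a (real N - \<nu>) u) t)"

end

theory Submission
  imports Defs
begin

text \<open>
  Encode \<open>u\<close> by the formal power series \<open>V = \<Sum>\<^sub>k u (a + k) X\<^sup>k\<close>. The nabla fractional sum of order \<open>\<nu>\<close>
  is multiplication by \<open>(1 - X)\<^sup>-\<^sup>\<nu>\<close>, and \<open>\<nabla>\<close> is multiplication by \<open>1 - X\<close>, so \<open>\<nabla>\<^sup>\<alpha>\<close> is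
  multiplication by \<open>(1 - X)\<^sup>\<alpha>\<close>. Inverting, a solution satisfies
  \<open>u (a + k) = - \<Sum>\<^sub>i c (k - i) q (a + i) u (a + i)\<close>, where the coefficients \<open>c\<close> of \<open>(1 - X)\<^sup>-\<^sup>\<alpha>\<close> are
  nonnegative and increasing because \<open>\<alpha> > 1\<close>. As \<open>u\<close> vanishes at \<open>a + 1\<close>, the sum starts at
  \<open>i = 2\<close>, and evaluating at a point where \<open>\<bar>u\<bar>\<close> is maximal bounds \<open>\<Sum> \<bar>q\<bar>\<close> below by
  \<open>1 / c (b - a - 2)\<close>.
\<close>

unbundle no vec_syntax
unbundle fps_syntax

text \<open>The coefficients of \<open>(1 - X)\<^sup>-\<^sup>r\<close>.\<close>

definition rising_coeff :: "real \<Rightarrow> nat \<Rightarrow> real" where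
  "rising_coeff r m = pochhammer r m / fact m"

definition rising_fps :: "real \<Rightarrow> real fps" where
  "rising_fps r = Abs_fps (rising_coeff r)"

lemma rising_fps_nth [simp]: "rising_fps r $ m = rising_coeff r m"
  by (simp add: rising_fps_def)

text \<open>The Chu-Vandermonde identity for \<open>pochhammer\<close>, divided by
  \<open>fact n\<close>; this is the law of exponents for powers of 1 - X.\<close>

lemma rising_fps_add: "rising_fps (r + s) = rising_fps r * rising_fps s"
proof (rule fps_ext)
  fix n
  have "rising_coeff (r + s) n =
      (\<Sum>k\<le>n. of_nat (n choose k) * pochhammer r k * pochhammer s (n - k)) / fact n"
    by (simp add: rising_coeff_def pochhammer_binomial_sum)
  also have "\<dots> = (\<Sum>k\<le>n. rising_coeff r k * rising_coeff s (n - k))"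
    unfolding sum_divide_distrib
    by (intro sum.cong) (auto simp: rising_coeff_def binomial_fact)
  finally show "rising_fps (r + s) $ n = (rising_fps r * rising_fps s) $ n"
    by (simp add: fps_mult_nth atLeast0AtMost)
qed

lemma one_minus_X_mult_nth:
  fixes f :: "'a::comm_ring_1 fps"
  shows "((1 - fps_X) * f) $ k = f $ k - (if k = 0 then 0 else f $ (k - 1))"
  by (simp add: algebra_simps)

lemma one_minus_X_mult_rising_fps_1: "(1 - fps_X) * rising_fps 1 = 1"
  by (rule fps_ext)
    (simp add: one_minus_X_mult_nth rising_coeff_def pochhammer_fact[symmetric])

lemma rising_coeff_pos: "0 < r \<Longrightarrow> 0 < rising_coeff r m"
  by (simp add: rising_coeff_def pochhammer_pos)

text \<open>Consecutive coefficients have ratio (r + k) / (k + 1), which is at least 1 once r \<ge>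
  1.\<close>

lemma rising_coeff_mono:
  assumes "1 \<le> r" and "m \<le> n"
  shows "rising_coeff r m \<le> rising_coeff r n"
proof (rule lift_Suc_mono_le[OF _ assms(2)])
  fix k
  have "rising_coeff r (Suc k) = rising_coeff r k * ((r + real k) / real (Suc k))"
    by (simp add: rising_coeff_def pochhammer_Suc)
  moreover have "1 \<le> (r + real k) / real (Suc k)"
    using assms(1) by (simp add: field_simps)
  ultimately show "rising_coeff r k \<le> rising_coeff r (Suc k)"
    using rising_coeff_pos[of r k] assms(1) by (simp add: pos_le_divide_eq)
qed

text \<open>Links the Gamma quotient in the kernel of the fractional sum to power series
  coefficients. As m + 1 > 0, the convention for \<open>rising 0\<close> does not interfere.\<close>

lemma rising_eq_rising_coeff:
  assumes "0 < r"
  shows "rising (real m + 1) (r - 1) = Gamma r * rising_coeff r m"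
proof -
  have "r \<notin> \<int>\<^sub>\<le>\<^sub>0"
    using assms by (auto elim!: nonpos_Ints_cases)
  then have "Gamma (r + real m) = Gamma r * pochhammer r m"
    using assms by (simp add: pochhammer_Gamma Gamma_eq_zero_iff)
  moreover have "Gamma (real m + 1) = fact m"
    using Gamma_fact[of m, where 'a = real] by (simp add: add.commute)
  ultimately show ?thesis
    by (simp add: rising_def rising_coeff_def add.commute)
qed

lemma nabla_Icc_shift:
  "nabla_Icc (a + real i) (a + real k) = (\<lambda>j. a + real j) ` {i..k}"
proof (intro equalityI subsetI)
  fix t
  assume "t \<in> nabla_Icc (a + real i) (a + real k)"
  then obtain m where "t \<le> a + real k" "t = a + real i + real m"
    by (auto simp: nabla_Icc_def)
  then have "t = a + real (i + m)" "i + m \<in> {i..k}"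
    by auto
  then show "t \<in> (\<lambda>j. a + real j) ` {i..k}"
    by blast
next
  fix t
  assume "t \<in> (\<lambda>j. a + real j) ` {i..k}"
  then obtain j where "i \<le> j" "j \<le> k" "t = a + real j"
    by auto
  then show "t \<in> nabla_Icc (a + real i) (a + real k)"
    by (auto simp: nabla_Icc_def intro!: exI[of _ "j - i"])
qed

lemma sum_nabla_Icc_shift:
  "(\<Sum>s\<in>nabla_Icc (a + real i) (a + real k). f s) = (\<Sum>j=i..k. f (a + real j))"
  by (simp add: nabla_Icc_shift sum.reindex inj_on_def)

text \<open>The constant coefficient is set to 0 because sums based at \<open>a\<close> start at
  \<open>a + 1\<close>: the value \<open>u a\<close> must not enter.\<close>

definition nabla_fps :: "real \<Rightarrow> (real \<Rightarrow> real) \<Rightarrow> real fps" where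
  "nabla_fps a u = Abs_fps (\<lambda>k. if k = 0 then 0 else u (a + real k))"

lemma nabla_fps_nth: "nabla_fps a u $ k = (if k = 0 then 0 else u (a + real k))"
  by (simp add: nabla_fps_def)

text \<open>The kernel depends only on t - s, so the fractional sum is a convolution, that is, a
  Cauchy product.\<close>

lemma nabla_frac_sum_eq_fps:
  assumes "0 < \<nu>"
  shows "nabla_frac_sum a \<nu> u (a + real k) = (rising_fps \<nu> * nabla_fps a u) $ k"
proof -
  have "Gamma \<nu> \<noteq> 0"
    using Gamma_real_pos[OF assms] by simp
  have rising: "rising (real k - real j + 1) (\<nu> - 1) = Gamma \<nu> * rising_coeff \<nu> (k - j)"
    if "j \<le> k" for j
    using rising_eq_rising_coeff[OF assms, of "k - j"] that by (simp add: of_nat_diff)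
  have "nabla_frac_sum a \<nu> u (a + real k) =
      1 / Gamma \<nu> * (\<Sum>j=1..k. rising (real k - real j + 1) (\<nu> - 1) * u (a + real j))"
    using assms sum_nabla_Icc_shift[where a = a and i = 1 and k = k and 'a = real]
    by (simp add: nabla_frac_sum_def)
  also have "\<dots> = (\<Sum>j=1..k. nabla_fps a u $ j * rising_fps \<nu> $ (k - j))"
    unfolding sum_distrib_left using \<open>Gamma \<nu> \<noteq> 0\<close>
    by (intro sum.cong) (auto simp: rising nabla_fps_nth)
  also have "\<dots> = (\<Sum>j=0..k. nabla_fps a u $ j * rising_fps \<nu> $ (k - j))"
    by (intro sum.mono_neutral_left) (auto simp: nabla_fps_nth)
  also have "\<dots> = (rising_fps \<nu> * nabla_fps a u) $ k"
    by (simp add: fps_mult_nth mult.commute[of "rising_fps \<nu>"])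
  finally show ?thesis .
qed

text \<open>Here N = 2. For k \<ge> 2 the second difference reads coefficients k, k - 1 and k - 2
  only, so no truncation at index 0 occurs.\<close>

lemma nabla_frac_diff_eq_fps:
  assumes "1 < \<alpha>" "\<alpha> < 2" "2 \<le> k"
  shows "nabla_frac_diff a \<alpha> u (a + real k) =
    ((1 - fps_X)\<^sup>2 * rising_fps (2 - \<alpha>) * nabla_fps a u) $ k"
proof -
  obtain m where k: "k = Suc (Suc m)"
    using assms(3) by (metis add_2_eq_Suc le_Suc_ex)
  define S where "S = rising_fps (2 - \<alpha>) * nabla_fps a u"
  have "\<lceil>\<alpha>\<rceil> = 2"
    using assms by (simp add: ceiling_eq_iff)
  then have "nabla_frac_diff a \<alpha> u (a + real k) = nabla (nabla (nabla_frac_sum a (2 - \<alpha>) u)) (a + real k)"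
    by (simp add: nabla_frac_diff_def numeral_2_eq_2)
  also have "\<dots> = nabla_frac_sum a (2 - \<alpha>) u (a + real k)
      - 2 * nabla_frac_sum a (2 - \<alpha>) u (a + real (Suc m))
      + nabla_frac_sum a (2 - \<alpha>) u (a + real m)"
    by (simp add: nabla_def k add.commute add.left_commute)
  also have "\<dots> = S $ k - 2 * S $ Suc m + S $ m"
    using assms(2) by (simp add: nabla_frac_sum_eq_fps S_def del: of_nat_Suc)
  also have "\<dots> = ((1 - fps_X) * ((1 - fps_X) * S)) $ k"
    unfolding one_minus_X_mult_nth[of _ "_"] by (simp add: k)
  finally show ?thesis
    by (simp add: S_def power2_eq_square mult.assoc)
qed

text \<open>Since \<alpha> + (2 - \<alpha>) = 1 + 1, the series combine to (1 - X)^(-2), which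
  cancels the square.\<close>

lemma nabla_fps_inversion:
  "rising_fps \<alpha> * ((1 - fps_X)\<^sup>2 * rising_fps (2 - \<alpha>) * nabla_fps a u) = nabla_fps a u"
proof -
  have "rising_fps \<alpha> * rising_fps (2 - \<alpha>) = rising_fps 1 * rising_fps 1"
    unfolding rising_fps_add[symmetric] by simp
  then have "rising_fps \<alpha> * ((1 - fps_X)\<^sup>2 * rising_fps (2 - \<alpha>) * nabla_fps a u) =
      ((1 - fps_X) * rising_fps 1)\<^sup>2 * nabla_fps a u"
    by (simp add: power2_eq_square ac_simps)
  then show ?thesis
    by (simp add: one_minus_X_mult_rising_fps_1)
qed

lemma solution_representation:
  assumes "1 < \<alpha>" "\<alpha> < 2" "1 \<le> k" "k \<le> n"
    and eq: "\<And>i. 2 \<le> i \<Longrightarrow> i \<le> n \<Longrightarrow>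
      nabla_frac_diff a \<alpha> u (a + real i) = - q (a + real i) * u (a + real i)"
    and "u (a + 1) = 0"
  shows "u (a + real k) =
    - (\<Sum>i=2..k. q (a + real i) * u (a + real i) * rising_coeff \<alpha> (k - i))"
proof -
  define E where "E = (1 - fps_X)\<^sup>2 * rising_fps (2 - \<alpha>) * nabla_fps a u"
  \<comment> \<open>The equation says nothing about coefficients 0 and 1. They vanish because X^2
    divides \<open>nabla_fps a u\<close>, by the convention at 0 and the left boundary
    condition.\<close>
  have "E $ i = 0" if "i < 2" for i
  proof -
    have "nabla_fps a u $ j = 0" if "j < 2" for j
      using that \<open>u (a + 1) = 0\<close> by (cases j) (auto simp: nabla_fps_nth)
    with that show ?thesis
      unfolding E_def fps_mult_nth[of _ "nabla_fps a u"] by (intro sum.neutral) auto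
  qed
  moreover have "E $ i = - q (a + real i) * u (a + real i)" if "2 \<le> i" "i \<le> n" for i
    using eq[OF that] nabla_frac_diff_eq_fps[OF assms(1,2) that(1), of a u] by (simp add: E_def)
  ultimately have E: "i < 2 \<Longrightarrow> E $ i = 0"
    "2 \<le> i \<Longrightarrow> i \<le> n \<Longrightarrow> E $ i = - q (a + real i) * u (a + real i)" for i
    by blast+
  have "u (a + real k) = (E * rising_fps \<alpha>) $ k"
    using nabla_fps_inversion[of \<alpha> a u, folded E_def] \<open>1 \<le> k\<close>
    by (simp add: mult.commute[of E] nabla_fps_nth del: mult_cancel_left mult_cancel_right)
  also have "\<dots> = (\<Sum>i=2..k. E $ i * rising_coeff \<alpha> (k - i))"
    unfolding fps_mult_nth by (intro sum.mono_neutral_cong_right) (auto simp: E)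
  also have "\<dots> = - (\<Sum>i=2..k. q (a + real i) * u (a + real i) * rising_coeff \<alpha> (k - i))"
    unfolding sum_negf[symmetric] using \<open>k \<le> n\<close> by (intro sum.cong) (auto simp: E)
  finally show ?thesis .
qed

theorem theorem4p5:
  fixes \<alpha> a b :: real and q :: "real \<Rightarrow> real"
  assumes "1 < \<alpha>" and "\<alpha> < 2"
    and "b - a \<in> \<int>" and "b - a \<ge> 2"
    and "\<exists>u :: real \<Rightarrow> real.
           (\<forall>t\<in>nabla_Icc (a + 2) b. nabla_frac_diff a \<alpha> u t + q t * u t = 0) \<and>
           u (a + 1) = 0 \<and> nabla_frac_diff a (\<alpha> - 1) u b = 0 \<and>
           (\<exists>t\<in>nabla_Icc (a + 1) b. u t \<noteq> 0)"
  shows "(\<Sum>s\<in>nabla_Icc (a + 2) b. \<bar>q s\<bar>) \<ge> Gamma \<alpha> / rising (b - a - 1) (\<alpha> - 1)"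
proof -
  have "b - a \<in> \<nat>"
    using assms(3,4) by (simp add: Nats_altdef2)
  then obtain n where "b - a = real n"
    by (auto elim: Nats_cases)
  then have b: "b = a + real n" and "2 \<le> n"
    using assms(4) by auto
  obtain u where
    eq: "\<And>t. t \<in> nabla_Icc (a + 2) b \<Longrightarrow> nabla_frac_diff a \<alpha> u t + q t * u t = 0"
    and u1: "u (a + 1) = 0" and nontriv: "\<exists>t\<in>nabla_Icc (a + 1) b. u t \<noteq> 0"
    using assms(5) by blast
  have I2: "nabla_Icc (a + 2) b = (\<lambda>j. a + real j) ` {2..n}"
    and I1: "nabla_Icc (a + 1) b = (\<lambda>j. a + real j) ` {1..n}"
    using nabla_Icc_shift[of a 2 n] nabla_Icc_shift[of a 1 n] by (simp_all add: b)
  \<comment> \<open>The largest kernel value that can occur: k - i is at most n - 2, attained at k =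
    n, i = 2.\<close>
  define c where "c = rising_coeff \<alpha> (n - 2)"
  define Q where "Q = (\<Sum>s\<in>nabla_Icc (a + 2) b. \<bar>q s\<bar>)"
  define M where "M = Max ((\<lambda>j. \<bar>u (a + real j)\<bar>) ` {1..n})"
  have le_M: "\<bar>u (a + real j)\<bar> \<le> M" if "1 \<le> j" "j \<le> n" for j
    unfolding M_def using that by (intro Max_ge) auto
  have "M \<in> (\<lambda>j. \<bar>u (a + real j)\<bar>) ` {1..n}"
    unfolding M_def using \<open>2 \<le> n\<close> by (intro Max_in) auto
  then obtain k where k: "1 \<le> k" "k \<le> n" and M: "M = \<bar>u (a + real k)\<bar>"
    by auto
  have "0 < M"
  proof -
    obtain j where "1 \<le> j" "j \<le> n" "u (a + real j) \<noteq> 0"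
      using nontriv I1 by auto
    with le_M[of j] show ?thesis
      by linarith
  qed
  have "0 < c"
    using assms(1) by (simp add: c_def rising_coeff_pos)
  have Q: "Q = (\<Sum>i=2..n. \<bar>q (a + real i)\<bar>)"
    using sum_nabla_Icc_shift[of "\<lambda>s. \<bar>q s\<bar>" a 2 n] by (simp add: Q_def b)
  have "nabla_frac_diff a \<alpha> u (a + real i) = - q (a + real i) * u (a + real i)"
    if "2 \<le> i" "i \<le> n" for i
    using eq[of "a + real i"] that I2 by auto
  note repr = solution_representation[OF assms(1,2) k this u1]
  \<comment> \<open>The representation is evaluated at a point \<open>k\<close> where the maximum
    \<open>M\<close> is attained, so that \<open>M\<close> appears on both sides and can be
    cancelled.\<close>
  have "M = \<bar>\<Sum>i=2..k. q (a + real i) * u (a + real i) * rising_coeff \<alpha> (k - i)\<bar>"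
    unfolding M by (subst repr) (simp_all only: abs_minus_cancel)
  also have "\<dots> \<le> (\<Sum>i=2..k. \<bar>q (a + real i) * u (a + real i) * rising_coeff \<alpha> (k - i)\<bar>)"
    by (rule sum_abs)
  also have "\<dots> \<le> (\<Sum>i=2..k. \<bar>q (a + real i)\<bar> * (M * c))"
  proof (rule sum_mono)
    fix i
    assume i: "i \<in> {2..k}"
    have "rising_coeff \<alpha> (k - i) \<le> c"
      unfolding c_def using assms(1) i k by (intro rising_coeff_mono) auto
    then have "\<bar>u (a + real i)\<bar> * rising_coeff \<alpha> (k - i) \<le> M * c"
      using le_M[of i] i k \<open>0 < M\<close> assms(1)
      by (intro mult_mono) (auto intro!: less_imp_le[OF rising_coeff_pos])
    then show "\<bar>q (a + real i) * u (a + real i) * rising_coeff \<alpha> (k - i)\<bar> \<le>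
        \<bar>q (a + real i)\<bar> * (M * c)"
      using assms(1) rising_coeff_pos[of \<alpha> "k - i"]
      by (simp add: abs_mult mult.assoc mult_left_mono)
  qed
  \<comment> \<open>The maximum may lie before the right end; extending the sum from
    \<open>k\<close> to \<open>n\<close> adds only nonnegative terms.\<close>
  also have "\<dots> \<le> Q * (M * c)"
    unfolding Q sum_distrib_right using k \<open>0 < M\<close> \<open>0 < c\<close> by (intro sum_mono2) auto
  finally have "1 \<le> Q * c"
    using \<open>0 < M\<close> by (simp add: mult.left_commute)
  then have "1 / c \<le> Q"
    using \<open>0 < c\<close> by (simp add: divide_le_eq)
  \<comment> \<open>With b - a - 1 = (n - 2) + 1, the stated constant is exactly the reciprocal of
    \<open>c\<close>.\<close>
  moreover have "Gamma \<alpha> / rising (b - a - 1) (\<alpha> - 1) = 1 / c"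
  proof -
    have "b - a - 1 = real (n - 2) + 1"
      using \<open>2 \<le> n\<close> by (simp add: b of_nat_diff)
    then have "rising (b - a - 1) (\<alpha> - 1) = Gamma \<alpha> * c"
      using rising_eq_rising_coeff[of \<alpha> "n - 2"] assms(1) by (simp only: c_def)
    moreover have "Gamma \<alpha> > 0"
      using assms(1) by (simp add: Gamma_real_pos)
    ultimately show ?thesis
      by simp
  qed
  ultimately show ?thesis
    by (simp add: Q_def)
qed

end
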